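(* Let $\mathcal{O}$ be an Okubo algebra with isotropic norm over a field $\mathbb{F}$. Then the directed zero divisor graph $\Gamma_Z(\mathcal{O})$ is strongly connected, and $\operatorname{diam}\Gamma_Z(\mathcal{O}) = 2$.
   Context: For a field $\mathbb{F}$ (arbitrary characteristic) and nonzero $\alpha,\beta\in\mathbb{F}$, let $\mathcal{O}_{\alpha,\beta}$ be the $8$-dimensional $\mathbb{F}$-algebra with basis $z_{1,0},z_{2,0},z_{0,1},z_{0,2},z_{1,1},z_{2,2},z_{1,2},z_{2,1}$ and (bilinear, non-associative) multiplication $*$ given by the table (the entry in row $a$, column $b$ is $a*b$): $$\begin{array}{c|cccccccc} * & z_{1,0} & z_{2,0} & z_{0,1} & z_{0,2} & z_{1,1} & z_{2,2} & z_{1,2} & z_{2,1}\\ \hline z_{1,0} & z_{2,0} & 0 & -z_{1,1} & 0 & -z_{2,1} & 0 & 0 & -\alpha z_{0,1}\\ z_{2,0} & 0 & \alpha z_{1,0} & 0 & -z_{2,2} & 0 & -\alpha z_{1,2} & -\alpha z_{0,2} & 0\\ z_{0,1} & 0 & -z_{2,1} & z_{0,2} & 0 & 0 & -\beta z_{2,0} & 0 & -z_{2,2}\\ z_{0,2} & -z_{1,2} & 0 & 0 & \beta z_{0,1} & -\beta z_{1,0} & 0 & -\beta z_{1,1} & 0\\ z_{1,1} & 0 & -\alpha z_{0,1} & -z_{1,2} & 0 & z_{2,2} & 0 & -\beta z_{2,0} & 0\\ z_{2,2} & -\alpha z_{0,2} & 0 & 0 & -\beta z_{2,1} & 0 & \alpha\beta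 z_{1,1} & 0 & -\alpha\beta z_{1,0}\\ z_{1,2} & -z_{2,2} & 0 & -\beta z_{1,0} & 0 & 0 & -\alpha\beta z_{0,1} & \beta z_{2,1} & 0\\ z_{2,1} & 0 & -\alpha z_{1,1} & 0 & -\beta z_{2,0} & -\alpha z_{0,2} & 0 & 0 & \alpha z_{1,2}\end{array}$$ Its norm is the quadratic form $n$ with $n(z_{i,j})=0$ for all basis elements and polar form $n(a,b)=n(a+b)-n(a)-n(b)$ given on the basis by $n(z_{1,0},z_{2,0})=\alpha$, $n(z_{0,1},z_{0,2})=\beta$, $n(z_{1,1},z_{2,2})=n(z_{1,2},z_{2,1})=\alpha\beta$, and $0$ on all other pairs of basis elements. By the known classification, the Okubo algebras with isotropic norm over $\mathbb{F}$ are exactly the $\mathbb{F}$-algebras isomorphic to $\mathcal{O}_{\alpha,\beta}$ for some nonzero $\alpha,\beta\in\mathbb{F}$; take this as the definition. For an algebra $\mathcal{A}$, $Z(\mathcal{A})$ is the set of all zero divisors, i.e. nonzero $a$ such that $ab=0$ or $ba=0$ for some nonzero $b$. For $x\ne 0$ write $[x]=\mathbb{F}x$. The directed zero divisor graph $\Gamma_Z(\mathcal{A})$ has vertices the lines $[a]$, $a\in Z(\mathcal{A})$, and a directed edge $[a]\to[b]$ between distinct vertices $[a],[b]$ if and only if $ab=0$. The diameter is the supremum of the (directed) distances over all ordered pairs of vertices. *)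

theory Defs
  imports
    "HOL-Analysis.Cartesian_Space"
    "HOL-Library.Extended_Nat"
    "Graph_Theory.Arc_Walk"
    "Graph_Theory.Digraph_Component"
begin

section \<open>Non-associative algebras over a field\<close>

locale nonassoc_algebra = vector_space smul
  for smul :: "'f::field \<Rightarrow> 'a::ab_group_add \<Rightarrow> 'a" +
  fixes mul :: "'a \<Rightarrow> 'a \<Rightarrow> 'a"
  assumes linear_mult_left: "Vector_Spaces.linear smul smul (\<lambda>x. mul x y)"
    and linear_mult_right: "Vector_Spaces.linear smul smul (mul x)"

definition algebra_iso ::
  "('f::field \<Rightarrow> 'a::ab_group_add \<Rightarrow> 'a) \<Rightarrow> ('a \<Rightarrow> 'a \<Rightarrow> 'a) \<Rightarrow>
   ('f \<Rightarrow> 'b::ab_group_add \<Rightarrow> 'b) \<Rightarrow> ('b \<Rightarrow> 'b \<Rightarrow> 'b) \<Rightarrow> ('a \<Rightarrow> 'b) \<Rightarrow> bool"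
  where
  "algebra_iso s1 m1 s2 m2 f \<longleftrightarrow>
     Vector_Spaces.linear s1 s2 f \<and> bij f \<and> (\<forall>x y. f (m1 x y) = m2 (f x) (f y))"

section \<open>The algebras O(alpha, beta)\<close>

datatype okubo_index = I10 | I20 | I01 | I02 | I11 | I22 | I12 | I21

lemma UNIV_okubo_index: "UNIV = {I10, I20, I01, I02, I11, I22, I12, I21}"
  using okubo_index.exhaust by auto

instance okubo_index :: finite
  by standard (simp add: UNIV_okubo_index)

abbreviation okubo_basis :: "okubo_index \<Rightarrow> 'f::field ^ okubo_index" (\<open>z\<close>)
  where "z i \<equiv> axis i 1"

text \<open>The product of two basis vectors. All pairs that are not listed multiply to zero.\<close>

fun okubo_table :: "'f::field \<Rightarrow> 'f \<Rightarrow> okubo_index \<Rightarrow> okubo_index \<Rightarrow> 'f ^ okubo_index"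
  where
  "okubo_table \<alpha> \<beta> I10 I10 = z I20"
| "okubo_table \<alpha> \<beta> I10 I01 = - z I11"
| "okubo_table \<alpha> \<beta> I10 I11 = - z I21"
| "okubo_table \<alpha> \<beta> I10 I21 = - (\<alpha> *s z I01)"

| "okubo_table \<alpha> \<beta> I20 I20 = \<alpha> *s z I10"
| "okubo_table \<alpha> \<beta> I20 I02 = - z I22"
| "okubo_table \<alpha> \<beta> I20 I22 = - (\<alpha> *s z I12)"
| "okubo_table \<alpha> \<beta> I20 I12 = - (\<alpha> *s z I02)"

| "okubo_table \<alpha> \<beta> I01 I20 = - z I21"
| "okubo_table \<alpha> \<beta> I01 I01 = z I02"
| "okubo_table \<alpha> \<beta> I01 I22 = - (\<beta> *s z I20)"
| "okubo_table \<alpha> \<beta> I01 I21 = - z I22"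

| "okubo_table \<alpha> \<beta> I02 I10 = - z I12"
| "okubo_table \<alpha> \<beta> I02 I02 = \<beta> *s z I01"
| "okubo_table \<alpha> \<beta> I02 I11 = - (\<beta> *s z I10)"
| "okubo_table \<alpha> \<beta> I02 I12 = - (\<beta> *s z I11)"

| "okubo_table \<alpha> \<beta> I11 I20 = - (\<alpha> *s z I01)"
| "okubo_table \<alpha> \<beta> I11 I01 = - z I12"
| "okubo_table \<alpha> \<beta> I11 I11 = z I22"
| "okubo_table \<alpha> \<beta> I11 I12 = - (\<beta> *s z I20)"

| "okubo_table \<alpha> \<beta> I22 I10 = - (\<alpha> *s z I02)"
| "okubo_table \<alpha> \<beta> I22 I02 = - (\<beta> *s z I21)"
| "okubo_table \<alpha> \<beta> I22 I22 = (\<alpha> * \<beta>) *s z I11"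
| "okubo_table \<alpha> \<beta> I22 I21 = - ((\<alpha> * \<beta>) *s z I10)"

| "okubo_table \<alpha> \<beta> I12 I10 = - z I22"
| "okubo_table \<alpha> \<beta> I12 I01 = - (\<beta> *s z I10)"
| "okubo_table \<alpha> \<beta> I12 I22 = - ((\<alpha> * \<beta>) *s z I01)"
| "okubo_table \<alpha> \<beta> I12 I12 = \<beta> *s z I21"

| "okubo_table \<alpha> \<beta> I21 I20 = - (\<alpha> *s z I11)"
| "okubo_table \<alpha> \<beta> I21 I02 = - (\<beta> *s z I20)"
| "okubo_table \<alpha> \<beta> I21 I11 = - (\<alpha> *s z I02)"
| "okubo_table \<alpha> \<beta> I21 I21 = \<alpha> *s z I12"

| "okubo_table _ _ _ _ = 0"

no_notation okubo_basis (\<open>z\<close>)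

definition okubo_mult ::
  "'f::field \<Rightarrow> 'f \<Rightarrow> 'f ^ okubo_index \<Rightarrow> 'f ^ okubo_index \<Rightarrow> 'f ^ okubo_index"
  where
  "okubo_mult \<alpha> \<beta> x y =
     (\<Sum>i\<in>UNIV. \<Sum>j\<in>UNIV. (x $ i * y $ j) *s okubo_table \<alpha> \<beta> i j)"

lemma okubo_mult_basis:
  "okubo_mult \<alpha> \<beta> (axis i 1) (axis j 1) = okubo_table \<alpha> \<beta> i j"
proof -
  have "okubo_mult \<alpha> \<beta> (axis i 1) (axis j 1) =
      (\<Sum>k\<in>UNIV. \<Sum>l\<in>UNIV. if l = j then (if k = i then okubo_table \<alpha> \<beta> k l else 0) else 0)"
    unfolding okubo_mult_def by (intro sum.cong refl) (auto simp: axis_def)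
  also have "\<dots> = okubo_table \<alpha> \<beta> i j"
    by (simp add: sum.delta)
  finally show ?thesis .
qed

lemma nonassoc_algebra_okubo:
  "nonassoc_algebra (*s) (okubo_mult \<alpha> \<beta> :: 'f::field ^ okubo_index \<Rightarrow> _)"
proof -
  have "Vector_Spaces.linear (*s) (*s) (\<lambda>x. okubo_mult \<alpha> \<beta> x y)"
    and "Vector_Spaces.linear (*s) (*s) (okubo_mult \<alpha> \<beta> x)" for x y :: "'f ^ okubo_index"
    by (auto intro!: Vector_Spaces.linear_iff[THEN iffD2] vec.vector_space_axioms
        simp: okubo_mult_def vec.scale_sum_right sum.distrib[symmetric]
          distrib_right distrib_left vec.scale_left_distrib mult_ac)
  then show ?thesis
    by (intro nonassoc_algebra.intro nonassoc_algebra_axioms.intro vec.vector_space_axioms)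
qed

text \<open>
  By the classification of Okubo algebras, those with isotropic norm are exactly the algebras
  isomorphic to some O(alpha, beta) with nonzero parameters; this is taken as the definition.
\<close>

definition isotropic_okubo_algebra ::
  "('f::field \<Rightarrow> 'a::ab_group_add \<Rightarrow> 'a) \<Rightarrow> ('a \<Rightarrow> 'a \<Rightarrow> 'a) \<Rightarrow> bool"
  where
  "isotropic_okubo_algebra smul mul \<longleftrightarrow>
     nonassoc_algebra smul mul \<and>
     (\<exists>\<alpha> \<beta>. \<alpha> \<noteq> 0 \<and> \<beta> \<noteq> 0 \<and> (\<exists>f. algebra_iso (*s) (okubo_mult \<alpha> \<beta>) smul mul f))"

section \<open>The directed zero divisor graph\<close>

definition zero_divisors :: "('a::zero \<Rightarrow> 'a \<Rightarrow> 'a) \<Rightarrow> 'a set"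
  where
  "zero_divisors mul = {a. a \<noteq> 0 \<and> (\<exists>b. b \<noteq> 0 \<and> (mul a b = 0 \<or> mul b a = 0))}"

definition line :: "('f \<Rightarrow> 'a \<Rightarrow> 'a) \<Rightarrow> 'a \<Rightarrow> 'a set"
  where "line smul x = range (\<lambda>c. smul c x)"

definition zero_divisor_digraph ::
  "('f::field \<Rightarrow> 'a::ab_group_add \<Rightarrow> 'a) \<Rightarrow> ('a \<Rightarrow> 'a \<Rightarrow> 'a) \<Rightarrow>
   ('a set, 'a set \<times> 'a set) pre_digraph"
  where
  "zero_divisor_digraph smul mul =
     \<lparr>verts = line smul ` zero_divisors mul,
      arcs = {(line smul a, line smul b) | a b.
                a \<in> zero_divisors mul \<and> b \<in> zero_divisors mul \<and>
                line smul a \<noteq> line smul b \<and> mul a b = 0},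
      tail = fst, head = snd\<rparr>"

section \<open>Distance and diameter of a directed graph\<close>

text \<open>The distance is infinite if there is no directed walk.\<close>

definition digraph_distance :: "('v, 'e) pre_digraph \<Rightarrow> 'v \<Rightarrow> 'v \<Rightarrow> enat"
  where
  "digraph_distance G u v = (INF p\<in>{p. pre_digraph.awalk G u p v}. enat (length p))"

definition digraph_diameter :: "('v, 'e) pre_digraph \<Rightarrow> enat"
  where
  "digraph_diameter G = (SUP u\<in>verts G. SUP v\<in>verts G. digraph_distance G u v)"

end

theory Submission
  imports Defs
begin

text \<open>
  In \<open>O(\<alpha>, \<beta>)\<close> one has \<open>(x y) x = n(x) y = x (y x)\<close>, so zero divisors are isotropic. Given
  isotropic \<open>a\<close> and \<open>b\<close>, a common neighbour, i.e. some \<open>c \<noteq> 0\<close> with \<open>a c = 0 = c b\<close>, is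
  \<open>c = b a\<close> if this is nonzero. If \<open>b a = 0\<close>, the polarised identity
  \<open>(u a) b + (b a) u = n(u, b) a\<close> shows that \<open>c = u a\<close> works for every \<open>u\<close> orthogonal to \<open>b\<close> with
  \<open>u a \<noteq> 0\<close>, and such \<open>u\<close> exist for reasons of rank. The diameter is not smaller than two since
  \<open>z\<^sub>1\<^sub>,\<^sub>0\<close> and \<open>z\<^sub>0\<^sub>,\<^sub>1\<close> are zero divisors with nonzero product.
\<close>

section \<open>The norm of the algebras O(alpha, beta)\<close>

lemma all_okubo_index_iff:
  "(\<forall>i. P i) \<longleftrightarrow> P I10 \<and> P I20 \<and> P I01 \<and> P I02 \<and> P I11 \<and> P I22 \<and> P I12 \<and> P I21"
  by (metis okubo_index.exhaust)

text \<open>The table sorted by output coordinate: identities in the algebra become polynomial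
  identities that \<open>algebra\<close> decides over any field, whatever its
  characteristic.\<close>

lemma okubo_mult_nth:
  "okubo_mult \<alpha> \<beta> x y $ I10 = \<alpha> * x$I20 * y$I20 - \<beta> * x$I02 * y$I11
     - \<alpha> * \<beta> * x$I22 * y$I21 - \<beta> * x$I12 * y$I01"
  "okubo_mult \<alpha> \<beta> x y $ I20 = x$I10 * y$I10 - \<beta> * x$I01 * y$I22
     - \<beta> * x$I11 * y$I12 - \<beta> * x$I21 * y$I02"
  "okubo_mult \<alpha> \<beta> x y $ I01 = \<beta> * x$I02 * y$I02 - \<alpha> * x$I10 * y$I21
     - \<alpha> * x$I11 * y$I20 - \<alpha> * \<beta> * x$I12 * y$I22"
  "okubo_mult \<alpha> \<beta> x y $ I02 = x$I01 * y$I01 - \<alpha> * x$I20 * y$I12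
     - \<alpha> * x$I22 * y$I10 - \<alpha> * x$I21 * y$I11"
  "okubo_mult \<alpha> \<beta> x y $ I11 = \<alpha> * \<beta> * x$I22 * y$I22 - x$I10 * y$I01
     - \<beta> * x$I02 * y$I12 - \<alpha> * x$I21 * y$I20"
  "okubo_mult \<alpha> \<beta> x y $ I22 = x$I11 * y$I11 - x$I20 * y$I02 - x$I01 * y$I21 - x$I12 * y$I10"
  "okubo_mult \<alpha> \<beta> x y $ I12 = \<alpha> * x$I21 * y$I21 - \<alpha> * x$I20 * y$I22
     - x$I02 * y$I10 - x$I11 * y$I01"
  "okubo_mult \<alpha> \<beta> x y $ I21 = \<beta> * x$I12 * y$I12 - x$I10 * y$I11
     - x$I01 * y$I20 - \<beta> * x$I22 * y$I02"
  by (simp_all add: okubo_mult_def UNIV_okubo_index axis_def algebra_simps)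

definition okubo_norm :: "'f::field \<Rightarrow> 'f \<Rightarrow> 'f ^ okubo_index \<Rightarrow> 'f"
  where "okubo_norm \<alpha> \<beta> x =
    \<alpha> * x$I10 * x$I20 + \<beta> * x$I01 * x$I02 + \<alpha> * \<beta> * (x$I11 * x$I22 + x$I12 * x$I21)"

definition okubo_polar :: "'f::field \<Rightarrow> 'f \<Rightarrow> 'f ^ okubo_index \<Rightarrow> 'f ^ okubo_index \<Rightarrow> 'f"
  where "okubo_polar \<alpha> \<beta> x y =
    \<alpha> * (x$I10 * y$I20 + x$I20 * y$I10) + \<beta> * (x$I01 * y$I02 + x$I02 * y$I01)
    + \<alpha> * \<beta> * (x$I11 * y$I22 + x$I22 * y$I11 + x$I12 * y$I21 + x$I21 * y$I12)"

text \<open>Together with its mirror image below, this is the identity of a symmetric composition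
  algebra, checked coordinatewise.\<close>

lemma okubo_mult_mult_left:
  "okubo_mult \<alpha> \<beta> (okubo_mult \<alpha> \<beta> x y) x = okubo_norm \<alpha> \<beta> x *s y"
  unfolding vec_eq_iff all_okubo_index_iff vector_smult_component okubo_mult_nth okubo_norm_def
  by (intro conjI; algebra)

lemma okubo_mult_mult_right:
  "okubo_mult \<alpha> \<beta> x (okubo_mult \<alpha> \<beta> y x) = okubo_norm \<alpha> \<beta> x *s y"
  unfolding vec_eq_iff all_okubo_index_iff vector_smult_component okubo_mult_nth okubo_norm_def
  by (intro conjI; algebra)

text \<open>The linearisation in \<open>x\<close> of \<open>(x y) x = n(x) y\<close>.\<close>

lemma okubo_mult_mult_polar:
  "okubo_mult \<alpha> \<beta> (okubo_mult \<alpha> \<beta> x y) w + okubo_mult \<alpha> \<beta> (okubo_mult \<alpha> \<beta> w y) x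
     = okubo_polar \<alpha> \<beta> x w *s y"
  unfolding vec_eq_iff all_okubo_index_iff vector_add_component vector_smult_component
    okubo_mult_nth okubo_polar_def
  by (intro conjI; algebra)

text \<open>Associativity of the polar form: right and left multiplication by \<open>y\<close> are
  adjoint to each other.\<close>

lemma okubo_polar_mult:
  "okubo_polar \<alpha> \<beta> (okubo_mult \<alpha> \<beta> x y) w = okubo_polar \<alpha> \<beta> x (okubo_mult \<alpha> \<beta> y w)"
  unfolding okubo_mult_nth okubo_polar_def by algebra

lemma okubo_polar_linear:
  "okubo_polar \<alpha> \<beta> (x + y) w = okubo_polar \<alpha> \<beta> x w + okubo_polar \<alpha> \<beta> y w"
  "okubo_polar \<alpha> \<beta> (x - y) w = okubo_polar \<alpha> \<beta> x w - okubo_polar \<alpha> \<beta> y w"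
  "okubo_polar \<alpha> \<beta> (c *s x) w = c * okubo_polar \<alpha> \<beta> x w"
  "okubo_polar \<alpha> \<beta> w (x + y) = okubo_polar \<alpha> \<beta> w x + okubo_polar \<alpha> \<beta> w y"
  "okubo_polar \<alpha> \<beta> w (x - y) = okubo_polar \<alpha> \<beta> w x - okubo_polar \<alpha> \<beta> w y"
  "okubo_polar \<alpha> \<beta> w (c *s x) = c * okubo_polar \<alpha> \<beta> w x"
  unfolding okubo_polar_def vector_add_component vector_minus_component vector_smult_component
  by algebra+

lemma okubo_polar_commute: "okubo_polar \<alpha> \<beta> x y = okubo_polar \<alpha> \<beta> y x"
  by (simp add: okubo_polar_def algebra_simps)

text \<open>Each basis vector pairs nontrivially with exactly one other, so pairing \<open>x\<close>
  with the basis returns its coordinates up to nonzero factors. Rescaling normalises the value to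
  1.\<close>

lemma okubo_polar_nondegenerate:
  assumes "\<alpha> \<noteq> 0" "\<beta> \<noteq> 0" "x \<noteq> 0"
  obtains y where "okubo_polar \<alpha> \<beta> x y = 1"
proof -
  have "\<exists>i. okubo_polar \<alpha> \<beta> x (axis i 1) \<noteq> 0"
  proof (rule ccontr)
    assume "\<not> ?thesis"
    then have "\<forall>i. okubo_polar \<alpha> \<beta> x (axis i 1) = 0" by simp
    then have "x = 0"
      using assms(1,2) unfolding vec_eq_iff all_okubo_index_iff
      by (simp add: okubo_polar_def axis_def)
    with \<open>x \<noteq> 0\<close> show False ..
  qed
  then obtain i where "okubo_polar \<alpha> \<beta> x (axis i 1) \<noteq> 0" ..
  then have "okubo_polar \<alpha> \<beta> x (inverse (okubo_polar \<alpha> \<beta> x (axis i 1)) *s axis i 1) = 1"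
    by (simp add: okubo_polar_linear)
  then show ?thesis by (rule that)
qed

lemma okubo_mult_linear:
  "okubo_mult \<alpha> \<beta> (x + y) w = okubo_mult \<alpha> \<beta> x w + okubo_mult \<alpha> \<beta> y w"
  "okubo_mult \<alpha> \<beta> (x - y) w = okubo_mult \<alpha> \<beta> x w - okubo_mult \<alpha> \<beta> y w"
  "okubo_mult \<alpha> \<beta> (c *s x) w = c *s okubo_mult \<alpha> \<beta> x w"
  "okubo_mult \<alpha> \<beta> w (x + y) = okubo_mult \<alpha> \<beta> w x + okubo_mult \<alpha> \<beta> w y"
  "okubo_mult \<alpha> \<beta> w (x - y) = okubo_mult \<alpha> \<beta> w x - okubo_mult \<alpha> \<beta> w y"
  "okubo_mult \<alpha> \<beta> w (c *s x) = c *s okubo_mult \<alpha> \<beta> w x"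
  unfolding vec_eq_iff all_okubo_index_iff okubo_mult_nth vector_add_component
    vector_minus_component vector_smult_component
  by (intro conjI; algebra)+

lemma okubo_mult_zero [simp]: "okubo_mult \<alpha> \<beta> 0 x = 0" "okubo_mult \<alpha> \<beta> x 0 = 0"
  by (simp_all add: okubo_mult_def)

section \<open>Two-step connections between zero divisors\<close>

text \<open>If \<open>x y = 0\<close> or \<open>y x = 0\<close> with \<open>y\<close> nonzero, one
  of the two composition identities yields \<open>n(x) y = 0\<close>.\<close>

lemma zero_divisors_okubo_isotropic:
  assumes "x \<in> zero_divisors (okubo_mult \<alpha> \<beta>)"
  shows "okubo_norm \<alpha> \<beta> x = 0"
  using assms okubo_mult_mult_left[of \<alpha> \<beta> x] okubo_mult_mult_right[of \<alpha> \<beta> x]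
  unfolding zero_divisors_def mem_Collect_eq
  by (metis okubo_mult_zero vec.scale_eq_0_iff)

text \<open>Both functionals are packed into an endomorphism \<open>h\<close> whose image misses a
  basis vector. In finite dimension \<open>h\<close> is then not injective, and its kernel is the
  common zero set.\<close>

lemma ex_common_zero_functionals:
  fixes f g :: "'f::field ^ okubo_index \<Rightarrow> 'f"
  assumes f: "Vector_Spaces.linear (*s) (*) f" and g: "Vector_Spaces.linear (*s) (*) g"
  obtains y where "y \<noteq> 0" "f y = 0" "g y = 0"
proof -
  define h :: "'f ^ okubo_index \<Rightarrow> 'f ^ okubo_index"
    where "h y = f y *s axis I10 1 + g y *s axis I20 1" for y
  have lin: "Vector_Spaces.linear (*s) (*s) h"
    using f g
    by (auto simp: Vector_Spaces.linear_iff h_def vec.vector_space_axioms algebra_simps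
        vec.scale_left_distrib)
  have "h y \<noteq> axis I01 1" for y
  proof
    assume "h y = axis I01 1"
    then have "h y $ I01 = 1" by (simp add: axis_def)
    then show False by (simp add: h_def axis_def)
  qed
  then have "\<not> surj h" by (metis surjD)
  then have "\<not> inj h" using vec.linear_inj_imp_surj[OF lin] by blast
  then obtain y where "y \<noteq> 0" "h y = 0"
    using vec.linear_inj_iff_eq_0[OF lin] by blast
  moreover have "h y $ I10 = f y" "h y $ I20 = g y" by (simp_all add: h_def axis_def)
  ultimately show ?thesis by (intro that) simp_all
qed

text \<open>
  Otherwise right multiplication by \<open>a\<close>, and by adjointness also left multiplication by \<open>a\<close>, has
  rank at most one. This contradicts \<open>y = (a y) v + (v y) a\<close> for \<open>n(a, v) = 1\<close>.
\<close>

lemma ex_orthogonal_mult_nonzero: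
  fixes a b :: "'f::field ^ okubo_index"
  assumes nz: "\<alpha> \<noteq> 0" "\<beta> \<noteq> 0" and "a \<noteq> 0" "b \<noteq> 0"
  obtains u where "okubo_polar \<alpha> \<beta> u b = 0" "okubo_mult \<alpha> \<beta> u a \<noteq> 0"
proof (rule ccontr)
  assume "\<not> thesis"
  with that have kill: "okubo_mult \<alpha> \<beta> u a = 0" if "okubo_polar \<alpha> \<beta> u b = 0" for u
    using that by blast
  obtain v where v: "okubo_polar \<alpha> \<beta> a v = 1"
    using okubo_polar_nondegenerate nz \<open>a \<noteq> 0\<close> by blast
  obtain w where w: "okubo_polar \<alpha> \<beta> b w = 1"
    using okubo_polar_nondegenerate nz \<open>b \<noteq> 0\<close> by blast
  \<comment> \<open>The first functional is to force \<open>a y = 0\<close>; the second puts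
    \<open>v y\<close> into the orthogonal space of \<open>b\<close>, so that \<open>kill\<close>
    gives \<open>(v y) a = 0\<close>.\<close>
  have lin: "Vector_Spaces.linear (*s) (*) (okubo_polar \<alpha> \<beta> (okubo_mult \<alpha> \<beta> w a))"
    "Vector_Spaces.linear (*s) (*) (\<lambda>y. okubo_polar \<alpha> \<beta> (okubo_mult \<alpha> \<beta> v y) b)"
    by (auto simp: Vector_Spaces.linear_iff vec.vector_space_axioms
        vector_space_over_itself.vector_space_axioms okubo_polar_linear
        okubo_mult_linear)
  obtain y where "y \<noteq> 0" and y: "okubo_polar \<alpha> \<beta> (okubo_mult \<alpha> \<beta> w a) y = 0"
    "okubo_polar \<alpha> \<beta> (okubo_mult \<alpha> \<beta> v y) b = 0"
    by (rule ex_common_zero_functionals[OF lin])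
  have "okubo_polar \<alpha> \<beta> (okubo_mult \<alpha> \<beta> a y) u = 0" for u
  proof -
    \<comment> \<open>As \<open>n(b, w) = 1\<close>, subtracting this multiple of \<open>w\<close>
      projects \<open>u\<close> into the orthogonal space of \<open>b\<close>. Hence
      \<open>u a\<close> is always a multiple of \<open>w a\<close>, which is orthogonal to
      \<open>y\<close>.\<close>
    have "okubo_mult \<alpha> \<beta> (u - okubo_polar \<alpha> \<beta> u b *s w) a = 0"
      by (rule kill) (simp add: okubo_polar_linear okubo_polar_commute[of _ _ w] w)
    then have "okubo_mult \<alpha> \<beta> u a = okubo_polar \<alpha> \<beta> u b *s okubo_mult \<alpha> \<beta> w a"
      by (simp add: okubo_mult_linear)
    then have "okubo_polar \<alpha> \<beta> (okubo_mult \<alpha> \<beta> u a) y = 0"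
      by (simp add: okubo_polar_linear y)
    then show ?thesis by (metis okubo_polar_mult okubo_polar_commute)
  qed
  then have "okubo_mult \<alpha> \<beta> a y = 0"
    by (metis nz okubo_polar_nondegenerate zero_neq_one)
  moreover have "okubo_mult \<alpha> \<beta> (okubo_mult \<alpha> \<beta> v y) a = 0"
    using kill y(2) by blast
  ultimately have "y = 0"
    using okubo_mult_mult_polar[of \<alpha> \<beta> a y v] v by simp
  with \<open>y \<noteq> 0\<close> show False ..
qed

lemma ex_okubo_connecting:
  fixes a b :: "'f::field ^ okubo_index"
  assumes nz: "\<alpha> \<noteq> 0" "\<beta> \<noteq> 0"
    and a: "a \<in> zero_divisors (okubo_mult \<alpha> \<beta>)" and b: "b \<in> zero_divisors (okubo_mult \<alpha> \<beta>)"
  shows "\<exists>c. c \<noteq> 0 \<and> okubo_mult \<alpha> \<beta> a c = 0 \<and> okubo_mult \<alpha> \<beta> c b = 0"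
proof (cases "okubo_mult \<alpha> \<beta> b a = 0")
  case False
  \<comment> \<open>The witness is \<open>b a\<close>: \<open>a (b a) = n(a) b = 0\<close> and
    \<open>(b a) b = n(b) a = 0\<close>.\<close>
  then show ?thesis
    using zero_divisors_okubo_isotropic[OF a] zero_divisors_okubo_isotropic[OF b]
      okubo_mult_mult_left[of \<alpha> \<beta> b a] okubo_mult_mult_right[of \<alpha> \<beta> a b]
    by auto
next
  case True
  have "a \<noteq> 0" "b \<noteq> 0" using a b by (auto simp: zero_divisors_def)
  then obtain u where u: "okubo_polar \<alpha> \<beta> u b = 0" "okubo_mult \<alpha> \<beta> u a \<noteq> 0"
    using ex_orthogonal_mult_nonzero nz by blast
  have "okubo_mult \<alpha> \<beta> (okubo_mult \<alpha> \<beta> u a) b = 0"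
    using okubo_mult_mult_polar[of \<alpha> \<beta> u a b] True u(1) by simp
  moreover have "okubo_mult \<alpha> \<beta> a (okubo_mult \<alpha> \<beta> u a) = 0"
    using okubo_mult_mult_right[of \<alpha> \<beta> a u] zero_divisors_okubo_isotropic[OF a] by simp
  ultimately show ?thesis using u(2) by blast
qed

section \<open>Zero divisor graphs of diameter two\<close>

context nonassoc_algebra
begin

lemma mul_scale:
  "mul (smul c x) y = smul c (mul x y)" "mul x (smul c y) = smul c (mul x y)"
  using linear_mult_left[of y] linear_mult_right[of x]
  by (simp_all add: Vector_Spaces.linear_iff)

lemma line_eqD:
  assumes "line smul a = line smul b" "a \<noteq> 0"
  shows "\<exists>c. c \<noteq> 0 \<and> a = smul c b"
proof -
  have "a \<in> line smul a" unfolding line_def by (metis rangeI scale_one)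
  then obtain c where "a = smul c b" using assms(1) by (auto simp: line_def)
  with \<open>a \<noteq> 0\<close> show ?thesis by auto
qed

text \<open>Arcs are defined through representatives of lines; this makes the choice of
  representatives irrelevant.\<close>

lemma mul_eq_0_line_cong:
  assumes "line smul a = line smul a'" "line smul b = line smul b'" "a \<noteq> 0" "b \<noteq> 0"
    and "mul a' b' = 0"
  shows "mul a b = 0"
  using line_eqD[OF assms(1,3)] line_eqD[OF assms(2,4)] assms(5) by (auto simp: mul_scale)

lemma arc_zero_divisor_digraph_iff:
  assumes "a \<in> zero_divisors mul" "b \<in> zero_divisors mul"
  shows "(line smul a, line smul b) \<in> arcs (zero_divisor_digraph smul mul)
    \<longleftrightarrow> line smul a \<noteq> line smul b \<and> mul a b = 0"
proof
  assume "(line smul a, line smul b) \<in> arcs (zero_divisor_digraph smul mul)"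
  then obtain a' b' where "line smul a = line smul a'" "line smul b = line smul b'"
    "mul a' b' = 0" "line smul a \<noteq> line smul b"
    by (auto simp: zero_divisor_digraph_def)
  with assms show "line smul a \<noteq> line smul b \<and> mul a b = 0"
    using mul_eq_0_line_cong[of a a' b b'] by (auto simp: zero_divisors_def)
next
  assume "line smul a \<noteq> line smul b \<and> mul a b = 0"
  with assms show "(line smul a, line smul b) \<in> arcs (zero_divisor_digraph smul mul)"
    by (auto simp: zero_divisor_digraph_def)
qed

lemma wf_digraph_zero_divisor_digraph: "wf_digraph (zero_divisor_digraph smul mul)"
  by unfold_locales (auto simp: zero_divisor_digraph_def)

text \<open>The connecting \<open>c\<close> may lie on the line of \<open>a\<close> or of
  \<open>b\<close>. Since the graph has no loops, the walk through \<open>c\<close> then has to be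
  shortened to a single arc.\<close>

lemma ex_short_awalk:
  assumes conn: "\<And>a b. a \<in> zero_divisors mul \<Longrightarrow> b \<in> zero_divisors mul
      \<Longrightarrow> \<exists>c. c \<noteq> 0 \<and> mul a c = 0 \<and> mul c b = 0"
    and u: "u \<in> verts (zero_divisor_digraph smul mul)"
    and v: "v \<in> verts (zero_divisor_digraph smul mul)"
  shows "\<exists>p. pre_digraph.awalk (zero_divisor_digraph smul mul) u p v \<and> length p \<le> 2"
proof -
  let ?G = "zero_divisor_digraph smul mul"
  interpret G: wf_digraph ?G by (rule wf_digraph_zero_divisor_digraph)
  have [simp]: "tail ?G = fst" "head ?G = snd" by (simp_all add: zero_divisor_digraph_def)
  obtain a b where a: "a \<in> zero_divisors mul" "u = line smul a"
    and b: "b \<in> zero_divisors mul" "v = line smul b"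
    using u v by (auto simp: zero_divisor_digraph_def)
  obtain c where c: "c \<noteq> 0" "mul a c = 0" "mul c b = 0" using conn a(1) b(1) by blast
  have cz: "c \<in> zero_divisors mul" using c a(1) by (auto simp: zero_divisors_def)
  have arcI: "(line smul x, line smul y) \<in> arcs ?G"
    if "x \<in> zero_divisors mul" "y \<in> zero_divisors mul" "line smul x \<noteq> line smul y" "mul x y = 0"
    for x y using arc_zero_divisor_digraph_iff that by blast
  have nz: "a \<noteq> 0" "b \<noteq> 0" using a b by (auto simp: zero_divisors_def)
  consider "u = v" | "u \<noteq> v" "line smul c = u \<or> line smul c = v"
    | "u \<noteq> v" "line smul c \<noteq> u" "line smul c \<noteq> v" by blast
  then show ?thesis
  proof cases
    case 1
    then show ?thesis using u by (intro exI[of _ "[]"]) (simp add: G.awalk_def)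
  next
    case 2
    \<comment> \<open>If \<open>c\<close> spans \<open>u\<close>, then \<open>c b = 0\<close>
      carries over to \<open>a b = 0\<close>; if it spans \<open>v\<close>, then
      \<open>a c = 0\<close> does.\<close>
    then have "mul a b = 0"
      using mul_eq_0_line_cong[of a c b b] mul_eq_0_line_cong[of a a b c] nz c a(2) b(2) by auto
    then have "(u, v) \<in> arcs ?G" using 2(1) a b arcI[of a b] by simp
    then show ?thesis using u by (intro exI[of _ "[(u, v)]"]) (simp add: G.awalk_def)
  next
    case 3
    have "(u, line smul c) \<in> arcs ?G" "(line smul c, v) \<in> arcs ?G"
      using 3 a b c cz arcI[of a c] arcI[of c b] by simp_all
    then show ?thesis using u
      by (intro exI[of _ "[(u, line smul c), (line smul c, v)]"]) (simp add: G.awalk_def)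
  qed
qed

text \<open>Connecting elements bound all distances by two. The pair \<open>a\<close>,
  \<open>b\<close> attains the bound: distinct lines exclude the empty walk, and the nonzero product
  excludes a single arc.\<close>

lemma zero_divisor_digraph_diameter_2:
  assumes conn: "\<And>a b. a \<in> zero_divisors mul \<Longrightarrow> b \<in> zero_divisors mul
      \<Longrightarrow> \<exists>c. c \<noteq> 0 \<and> mul a c = 0 \<and> mul c b = 0"
    and a: "a \<in> zero_divisors mul" and b: "b \<in> zero_divisors mul"
    and ab: "line smul a \<noteq> line smul b" "mul a b \<noteq> 0"
  shows "strongly_connected (zero_divisor_digraph smul mul)
    \<and> digraph_diameter (zero_divisor_digraph smul mul) = 2"
proof
  let ?G = "zero_divisor_digraph smul mul"
  interpret G: wf_digraph ?G by (rule wf_digraph_zero_divisor_digraph)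
  have [simp]: "tail ?G = fst" "head ?G = snd" by (simp_all add: zero_divisor_digraph_def)
  have verts: "line smul a \<in> verts ?G" "line smul b \<in> verts ?G"
    using a b by (auto simp: zero_divisor_digraph_def)
  have walk: "\<exists>p. G.awalk u p v \<and> length p \<le> 2" if "u \<in> verts ?G" "v \<in> verts ?G" for u v
    by (rule ex_short_awalk[OF _ that]) (rule conn)
  \<comment> \<open>Strong connectedness includes having a vertex, which \<open>verts\<close>
    supplies.\<close>
  show "strongly_connected ?G"
    unfolding strongly_connected_def G.reachable_awalk using verts walk by blast
  have "digraph_distance ?G u v \<le> 2" if "u \<in> verts ?G" "v \<in> verts ?G" for u v
  proof -
    obtain p where "G.awalk u p v" "length p \<le> 2" using walk[OF \<open>u \<in> verts ?G\<close> \<open>v \<in> verts ?G\<close>] by blast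
    then show ?thesis unfolding digraph_distance_def
      by (intro INF_lower2[of p]) (auto simp: numeral_eq_enat)
  qed
  then have "digraph_diameter ?G \<le> 2"
    unfolding digraph_diameter_def by (intro SUP_least)
  moreover have "2 \<le> digraph_distance ?G (line smul a) (line smul b)"
    unfolding digraph_distance_def
  proof (rule INF_greatest)
    fix p assume "p \<in> {p. G.awalk (line smul a) p (line smul b)}"
    then have walk: "G.awalk (line smul a) p (line smul b)" by simp
    have "p \<noteq> []" using walk ab(1) by (auto simp: G.awalk_def)
    moreover have "p \<noteq> [e]" for e
    proof
      assume "p = [e]"
      with walk have "(line smul a, line smul b) \<in> arcs ?G"
        by (cases e) (auto simp: G.awalk_def)
      with ab(2) show False using arc_zero_divisor_digraph_iff[OF a b] by blast
    qed
    \<comment> \<open>The rule \<open>remdups_adj.cases\<close> splits lists into empty ones,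
      singletons and those with at least two elements.\<close>
    ultimately have "2 \<le> length p" by (cases p rule: remdups_adj.cases) auto
    then show "2 \<le> enat (length p)" by (simp add: numeral_eq_enat)
  qed
  then have "2 \<le> digraph_diameter ?G"
    unfolding digraph_diameter_def using verts
    by (meson SUP_upper2)
  ultimately show "digraph_diameter ?G = 2" by (rule antisym)
qed

end

section \<open>Transfer along the isomorphism\<close>

lemma zero_divisors_algebra_iso:
  assumes "algebra_iso s1 m1 s2 m2 f"
  shows "f x \<in> zero_divisors m2 \<longleftrightarrow> x \<in> zero_divisors m1"
proof -
  have f0: "f y = 0 \<longleftrightarrow> y = 0" for y
    using assms by (metis algebra_iso_def bij_is_inj inj_eq module_hom.zero
        Vector_Spaces.linear.axioms(3) Vector_Spaces.linear_def)
  have mul: "m2 (f y) (f w) = f (m1 y w)" for y w using assms by (simp add: algebra_iso_def)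
  have surj: "surj f" using assms by (simp add: algebra_iso_def bij_is_surj)
  have "(\<exists>b. b \<noteq> 0 \<and> (m2 (f x) b = 0 \<or> m2 b (f x) = 0))
      \<longleftrightarrow> (\<exists>b. f b \<noteq> 0 \<and> (m2 (f x) (f b) = 0 \<or> m2 (f b) (f x) = 0))"
    \<comment> \<open>Surjectivity lets the cofactor \<open>b\<close> range over images under
      \<open>f\<close> only.\<close>
    using surj by (metis surjD)
  then show ?thesis by (simp add: zero_divisors_def f0 mul)
qed

theorem theorem2p19:
  fixes smul :: "'f::field \<Rightarrow> 'a::ab_group_add \<Rightarrow> 'a"
    and mul :: "'a \<Rightarrow> 'a \<Rightarrow> 'a"
  assumes "isotropic_okubo_algebra smul mul"
  shows "strongly_connected (zero_divisor_digraph smul mul)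
    \<and> digraph_diameter (zero_divisor_digraph smul mul) = 2"
proof -
  interpret nonassoc_algebra smul mul
    using assms by (simp add: isotropic_okubo_algebra_def)
  obtain \<alpha> \<beta> f where nz: "\<alpha> \<noteq> 0" "\<beta> \<noteq> 0" and iso: "algebra_iso (*s) (okubo_mult \<alpha> \<beta>) smul mul f"
    using assms by (auto simp: isotropic_okubo_algebra_def)
  interpret f: Vector_Spaces.linear "(*s)" smul f using iso by (simp add: algebra_iso_def)
  have mul: "mul (f x) (f y) = f (okubo_mult \<alpha> \<beta> x y)" for x y
    using iso by (simp add: algebra_iso_def)
  have "inj f" "surj f" using iso by (simp_all add: algebra_iso_def bij_is_inj bij_is_surj)
  then have f0: "f x = 0 \<longleftrightarrow> x = 0" for x by (metis f.zero inj_eq)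
  note zd = zero_divisors_algebra_iso[OF iso]
  show ?thesis
  proof (rule zero_divisor_digraph_diameter_2)
    fix a b assume "a \<in> zero_divisors mul" "b \<in> zero_divisors mul"
    moreover obtain x y where "a = f x" "b = f y" using \<open>surj f\<close> by (meson surjD)
    ultimately show "\<exists>c. c \<noteq> 0 \<and> mul a c = 0 \<and> mul c b = 0"
      using ex_okubo_connecting[OF nz, of x y] by (metis zd mul f0)
  next
    have axis_nz: "axis i 1 \<noteq> (0 :: 'f ^ okubo_index)" for i by (simp add: axis_eq_0_iff)
    \<comment> \<open>The table has zeros at \<open>(I10, I20)\<close> and
      \<open>(I01, I10)\<close>, while its entry at \<open>(I10, I01)\<close> is nonzero: the lines
      of the two chosen vectors are joined in one direction only.\<close>
    have "axis I10 1 \<in> zero_divisors (okubo_mult \<alpha> \<beta>)"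
      unfolding zero_divisors_def mem_Collect_eq
      by (intro conjI axis_nz exI[of _ "axis I20 1"]) (simp add: okubo_mult_basis)
    then show "f (axis I10 1) \<in> zero_divisors mul" by (simp add: zd)
    have "axis I01 1 \<in> zero_divisors (okubo_mult \<alpha> \<beta>)"
      unfolding zero_divisors_def mem_Collect_eq
      by (intro conjI axis_nz exI[of _ "axis I10 1"]) (simp add: okubo_mult_basis)
    then show "f (axis I01 1) \<in> zero_divisors mul" by (simp add: zd)
    show "mul (f (axis I10 1)) (f (axis I01 1)) \<noteq> 0"
      by (simp add: mul f0 okubo_mult_basis axis_nz)
    show "line smul (f (axis I10 1)) \<noteq> line smul (f (axis I01 1))"
    proof
      assume "line smul (f (axis I10 1)) = line smul (f (axis I01 1))"
      then obtain c where "f (axis I10 1) = smul c (f (axis I01 1))"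
        using line_eqD[of "f (axis I10 1)"] f0 axis_nz by blast
      then have "f (axis I10 1) = f (c *s axis I01 1)" by (simp add: f.scale)
      then have "axis I10 1 = c *s axis I01 (1::'f)" using \<open>inj f\<close> by (simp add: inj_eq)
      then have "axis I10 1 $ I10 = (c *s axis I01 (1::'f)) $ I10" by simp
      then show False by (simp add: axis_def)
    qed
  qed
qed

end
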